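(* There is no infinite sequence $(\mathcal D_Y^{(1)},\mathcal D_N^{(1)}),(\mathcal D_Y^{(2)},\mathcal D_N^{(2)}),\ldots$ of padded one-wise pairs of distributions in $\Delta_3$ such that $$\lim_{t\to\infty}\frac{\beta_{\{3\}}(\mathcal D_N^{(t)})}{\gamma_{\{3\}}(\mathcal D_Y^{(t)})}=\frac29.$$
   Context: $\Delta_k$ is the set of symmetric probability distributions on $\{-1,1\}^k$ (vectors with the same number of $1$'s are equiprobable). For $\mathcal D\in\Delta_k$, $\mu(\mathcal D)=\mathbb E_{\mathbf b\sim\mathcal D}[b_1]$. For $S\subseteq[k]$, $f_{S,k}(\mathbf x)=1$ iff the number of coordinates of $\mathbf x\in\{-1,1\}^k$ equal to $1$ lies in $S$ (and $0$ otherwise); $f_{\{3\},3}$ is the AND function on three bits. With $\mathrm{Bern}(p)$ equal to $1$ with probability $p$ and $-1$ with probability $1-p$, and $\odot$ the coordinatewise product, $\lambda_S(\mathcal D,p)=\mathbb E_{\mathbf a\sim\mathcal D,\ \mathbf b\sim\mathrm{Bern}(p)^k}[f_{S,k}(\mathbf a\odot\mathbf b)]$, $\beta_S(\mathcal D)=\sup_{p\in[0,1]}\lambda_S(\mathcal D,p)$ and $\gamma_S(\mathcal D)=\lambda_S(\mathcal D,1)$. Ratios with zero denominator are taken to be $+\infty$. A pair $(\mathcal D_Y,\mathcal D_N)$ of distributions in $\Delta_k$ is a *padded one-wise pair* if there exist $\tau\in[0,1]$ and $\mathcal D_0,\mathcal D'_Y,\mathcal D'_N\in\Delta_k$ such that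 $\mu(\mathcal D'_Y)=\mu(\mathcal D'_N)=0$, $\mathcal D_Y=\tau\mathcal D_0+(1-\tau)\mathcal D'_Y$ and $\mathcal D_N=\tau\mathcal D_0+(1-\tau)\mathcal D'_N$. *)

theory Defs
  imports "HOL-Probability.Probability"
begin

(* Vectors in {-1,1}^k are lists of length k; the paper's coordinate i is list index i - 1. *)
definition cube :: "nat \<Rightarrow> int list set" where
  "cube k = {x. length x = k \<and> set x \<subseteq> {-1, 1}}"

definition ones :: "int list \<Rightarrow> nat" where
  "ones x = card {i. i < length x \<and> x ! i = 1}"

definition Delta :: "nat \<Rightarrow> int list pmf set" where
  "Delta k = {D. set_pmf D \<subseteq> cube k \<and>
     (\<forall>x\<in>cube k. \<forall>y\<in>cube k. ones x = ones y \<longrightarrow> pmf D x = pmf D y)}"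

definition mu :: "int list pmf \<Rightarrow> real" where
  "mu D = measure_pmf.expectation D (\<lambda>b. real_of_int (b ! 0))"

definition f_S :: "nat set \<Rightarrow> int list \<Rightarrow> real" where
  "f_S S x = (if ones x \<in> S then 1 else 0)"

definition Bern :: "real \<Rightarrow> int pmf" where
  "Bern p = map_pmf (\<lambda>c. if c then 1 else -1) (bernoulli_pmf p)"

definition odot :: "int list \<Rightarrow> int list \<Rightarrow> int list" where
  "odot a b = map2 (*) a b"

definition lambda_S :: "nat \<Rightarrow> nat set \<Rightarrow> int list pmf \<Rightarrow> real \<Rightarrow> real" where
  "lambda_S k S D p =
     measure_pmf.expectation (pair_pmf D (replicate_pmf k (Bern p))) (\<lambda>(a, b). f_S S (odot a b))"

definition beta_S :: "nat \<Rightarrow> nat set \<Rightarrow> int list pmf \<Rightarrow> real" where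
  "beta_S k S D = (SUP p\<in>{0..1}. lambda_S k S D p)"

definition gamma_S :: "nat \<Rightarrow> nat set \<Rightarrow> int list pmf \<Rightarrow> real" where
  "gamma_S k S D = lambda_S k S D 1"

(* The usual real division would give 0 for a zero denominator, and ereal division gives 0 for 0 / 0. *)
definition ratio :: "real \<Rightarrow> real \<Rightarrow> ereal" where
  "ratio x y = (if y = 0 then \<infinity> else ereal (x / y))"

definition is_mixture :: "real \<Rightarrow> 'a pmf \<Rightarrow> 'a pmf \<Rightarrow> 'a pmf \<Rightarrow> bool" where
  "is_mixture \<tau> D D0 D' \<longleftrightarrow> (\<forall>x. pmf D x = \<tau> * pmf D0 x + (1 - \<tau>) * pmf D' x)"

definition padded_one_wise_pair :: "nat \<Rightarrow> int list pmf \<Rightarrow> int list pmf \<Rightarrow> bool" where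
  "padded_one_wise_pair k DY DN \<longleftrightarrow>
     DY \<in> Delta k \<and> DN \<in> Delta k \<and>
     (\<exists>\<tau>\<in>{0..1}. \<exists>D0\<in>Delta k. \<exists>DY'\<in>Delta k. \<exists>DN'\<in>Delta k.
        mu DY' = 0 \<and> mu DN' = 0 \<and> is_mixture \<tau> DY D0 DY' \<and> is_mixture \<tau> DN D0 DN')"

end

theory Submission imports Defs begin

text \<open>
  Write \<open>q\<^sub>0, \<dots>, q\<^sub>3\<close> for the probabilities that \<open>D\<close> gives to a single vector with \<open>i\<close> ones. Then
  \<open>\<lambda>(D, p) = \<Sum>i. (3 choose i) q\<^sub>i p^i (1 - p)^(3 - i)\<close>. The single bias \<open>p = 5/8\<close> already separates the
  ratio from 2/9: there \<open>512 p^i (1 - p)^(3 - i) \<ge> 60 + 15 (2 i - 3)\<close> for all \<open>i\<close>, so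
  \<open>\<lambda>(D', 5/8) \<ge> 60/512\<close> when \<open>\<mu>(D') = 0\<close>, whereas \<open>\<gamma>(D') \<le> 1/2\<close>; and the common part satisfies
  \<open>\<lambda>(D\<^sub>0, 5/8) \<ge> (5/8)^3 \<gamma>(D\<^sub>0)\<close>. Mixing gives \<open>\<beta>(D\<^sub>N) \<ge> (15/64) \<gamma>(D\<^sub>Y)\<close>, and 15/64 > 2/9.
\<close>

lemma finite_cube: "finite (cube k)"
  using finite_lists_length_eq[of "{-1, 1::int}" k] by (simp add: cube_def conj_commute)

lemma cube_0: "cube 0 = {[]}"
  by (auto simp: cube_def)

lemma cube_Suc: "cube (Suc k) = (#) (-1) ` cube k \<union> (#) 1 ` cube k"
proof -
  have "x \<in> (#) (-1) ` cube k \<union> (#) 1 ` cube k" if "x \<in> cube (Suc k)" for x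
    using that by (cases x) (auto simp: cube_def)
  then show ?thesis by (auto simp: cube_def)
qed

lemma ones_eq_count: "ones x = count_list x 1"
  by (simp add: ones_def count_list_eq_length_filter length_filter_conv_card eq_commute[of "1 :: int"])

text \<open>A product of two signs is 1 exactly when they agree.\<close>

lemma ones_odot_eq_length_iff:
  assumes "a \<in> cube k" "b \<in> cube k"
  shows "ones (odot a b) = k \<longleftrightarrow> a = b"
proof -
  have len: "length a = length b" using assms by (simp add: cube_def)
  \<comment> \<open>The upper bound is carried through the induction so that a mismatch at the head
    cannot be made up for by the tail.\<close>
  have "count_list (odot a b) 1 \<le> length a \<and> (count_list (odot a b) 1 = length a \<longleftrightarrow> a = b)"
    if "set a \<subseteq> {-1, 1}" "set b \<subseteq> {-1, 1}"
    using len that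
    by (induction rule: list_induct2) (auto simp: odot_def)
  then show ?thesis using assms by (simp add: cube_def ones_eq_count)
qed

lemma pmf_replicate_pmf:
  "pmf (replicate_pmf (length xs) p) xs = (\<Prod>x\<leftarrow>xs. pmf p x)"
proof (induction xs)
  case (Cons x xs)
  have "replicate_pmf (Suc (length xs)) p
      = map_pmf (\<lambda>(y, ys). y # ys) (pair_pmf p (replicate_pmf (length xs) p))"
    by (simp add: pair_pmf_def map_bind_pmf map_return_pmf)
  then have "pmf (replicate_pmf (length (x # xs)) p) (x # xs)
      = pmf (map_pmf (\<lambda>(y, ys). y # ys) (pair_pmf p (replicate_pmf (length xs) p)))
          ((\<lambda>(y, ys). y # ys) (x, xs))"
    by simp
  also have "\<dots> = pmf (pair_pmf p (replicate_pmf (length xs) p)) (x, xs)"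
    by (rule pmf_map_inj') (auto simp: inj_def)
  finally show ?case using Cons by (simp add: pmf_pair)
qed simp

lemma pmf_Bern:
  assumes "p \<in> {0..1}"
  shows "pmf (Bern p) 1 = p" "pmf (Bern p) (-1) = 1 - p"
proof -
  let ?f = "\<lambda>c. if c then 1 else -1 :: int"
  have "inj ?f" by (auto simp: inj_def)
  then have "pmf (Bern p) (?f c) = pmf (bernoulli_pmf p) c" for c
    unfolding Bern_def by (rule pmf_map_inj')
  from this[of True] this[of False] assms
  show "pmf (Bern p) 1 = p" "pmf (Bern p) (-1) = 1 - p" by auto
qed

lemma set_Bern: "set_pmf (Bern p) \<subseteq> {-1, 1}"
  by (auto simp: Bern_def)

lemma set_replicate_Bern: "set_pmf (replicate_pmf k (Bern p)) \<subseteq> cube k"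
  using set_Bern[of p] by (fastforce simp: set_replicate_pmf cube_def lists_eq_set)

text \<open>Only \<open>b = a\<close> contributes, so the expectation collapses to a single sum that
  is linear in the masses of \<open>D\<close>.\<close>

lemma lambda_S_full:
  assumes "D \<in> Delta k"
  shows "lambda_S k {k} D p = (\<Sum>a\<in>cube k. pmf D a * (\<Prod>x\<leftarrow>a. pmf (Bern p) x))"
proof -
  let ?R = "replicate_pmf k (Bern p)"
  have "lambda_S k {k} D p = (\<Sum>(a, b)\<in>cube k \<times> cube k.
      f_S {k} (odot a b) * pmf (pair_pmf D ?R) (a, b))"
    unfolding lambda_S_def
    using assms set_replicate_Bern[of k p]
    by (subst integral_measure_pmf_real[where A = "cube k \<times> cube k"])
       (auto simp: finite_cube Delta_def case_prod_unfold)
  also have "\<dots> = (\<Sum>a\<in>cube k. \<Sum>b\<in>cube k. if b = a then pmf D a * pmf ?R a else 0)"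
    unfolding sum.cartesian_product
    by (intro sum.cong) (auto simp: f_S_def ones_odot_eq_length_iff pmf_pair)
  also have "\<dots> = (\<Sum>a\<in>cube k. pmf D a * pmf ?R a)"
    by (simp add: finite_cube)
  also have "\<dots> = (\<Sum>a\<in>cube k. pmf D a * (\<Prod>x\<leftarrow>a. pmf (Bern p) x))"
    by (intro sum.cong) (auto simp: cube_def simp flip: pmf_replicate_pmf)
  finally show ?thesis .
qed

lemma lambda_S_le_beta_S:
  assumes "p \<in> {0..1}"
  shows "lambda_S k S D p \<le> beta_S k S D"
  unfolding beta_S_def
\<comment> \<open>A real supremum bounds its members only if the family is bounded above; 1 serves
  because \<open>f_S\<close> is an indicator.\<close>
proof (rule cSUP_upper[OF assms], rule bdd_aboveI2)
  fix p :: real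
  show "lambda_S k S D p \<le> 1"
    unfolding lambda_S_def
    by (intro measure_pmf.integral_le_const measure_pmf.integrable_const_bound[where B = 1])
       (auto simp: f_S_def)
qed

text \<open>Symmetry leaves four masses, which turns later estimates into linear arithmetic. In
  \<open>mu D\<close> the weights 3 drop to 1: among the three vectors with one 1 (or two 1's), the
  first coordinates sum to -1 (or 1).\<close>

lemma Delta_3_cases:
  assumes "D \<in> Delta 3"
  obtains q0 q1 q2 q3 where
    "q0 \<ge> 0" "q1 \<ge> 0" "q2 \<ge> 0" "q3 \<ge> 0" "q0 + 3 * q1 + 3 * q2 + q3 = 1"
    "mu D = q3 + q2 - q1 - q0"
    "\<And>p. p \<in> {0..1} \<Longrightarrow> lambda_S 3 {3} D p
        = q0 * (1 - p) ^ 3 + 3 * q1 * (p * (1 - p) ^ 2) + 3 * q2 * (p ^ 2 * (1 - p)) + q3 * p ^ 3"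
proof -
  let ?q0 = "pmf D [-1, -1, -1]" and ?q1 = "pmf D [1, -1, -1]"
    and ?q2 = "pmf D [1, 1, -1]" and ?q3 = "pmf D [1, 1, 1]"
  have cube: "cube 3 = {[-1,-1,-1], [1,-1,-1], [-1,1,-1], [-1,-1,1],
      [1,1,-1], [1,-1,1], [-1,1,1], [1,1,1]}"
    by (auto simp: numeral_3_eq_3 cube_Suc cube_0)
  have sub: "set_pmf D \<subseteq> cube 3" using assms by (simp add: Delta_def)
  have sym: "pmf D x = pmf D y" if "x \<in> cube 3" "y \<in> cube 3" "ones x = ones y" for x y
    using assms that unfolding Delta_def by blast
  have q: "pmf D [-1,1,-1] = ?q1" "pmf D [-1,-1,1] = ?q1"
    "pmf D [1,-1,1] = ?q2" "pmf D [-1,1,1] = ?q2"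
    by (rule sym; simp add: cube ones_eq_count)+
  have sum_cube: "(\<Sum>x\<in>cube 3. g x) = g [-1,-1,-1] + g [1,-1,-1] + g [-1,1,-1] + g [-1,-1,1]
      + g [1,1,-1] + g [1,-1,1] + g [-1,1,1] + g [1,1,1]" for g :: "int list \<Rightarrow> real"
    by (simp add: cube)
  have "(\<Sum>x\<in>cube 3. pmf D x) = 1"
    using sub by (simp add: sum_pmf_eq_1 finite_cube)
  then have total: "?q0 + 3 * ?q1 + 3 * ?q2 + ?q3 = 1"
    by (simp add: sum_cube q)
  have "mu D = (\<Sum>x\<in>cube 3. real_of_int (x ! 0) * pmf D x)"
    unfolding mu_def using sub by (intro integral_measure_pmf_real) (auto simp: finite_cube)
  then have mu: "mu D = ?q3 + ?q2 - ?q1 - ?q0"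
    by (simp add: sum_cube q)
  have lam: "lambda_S 3 {3} D p = ?q0 * (1 - p) ^ 3 + 3 * ?q1 * (p * (1 - p) ^ 2)
      + 3 * ?q2 * (p ^ 2 * (1 - p)) + ?q3 * p ^ 3" if "p \<in> {0..1}" for p
    unfolding lambda_S_full[OF assms] sum_cube
    by (simp add: q pmf_Bern[OF that] power2_eq_square power3_eq_cube algebra_simps)
  show thesis by (rule that[OF _ _ _ _ total mu lam]) simp_all
qed

lemma gamma_S_nonneg: "gamma_S k S D \<ge> 0"
  unfolding gamma_S_def lambda_S_def by (rule integral_nonneg_AE) (auto simp: f_S_def)

lemma lambda_S_ge_gamma_S:
  assumes "D \<in> Delta 3" "p \<in> {0..1}"
  shows "lambda_S 3 {3} D p \<ge> p ^ 3 * gamma_S 3 {3} D"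
  using assms(1)
proof (cases rule: Delta_3_cases)
  case (1 q0 q1 q2 q3)
  then show ?thesis using assms(2) by (simp add: gamma_S_def mult.commute)
qed

text \<open>The values 27, 45, 75, 125 of \<open>512 * p^i * (1 - p)^(3 - i)\<close> lie on or above
  the line through the middle two, and the mean of \<open>2 * i - 3\<close> is
  \<open>3 * mu D = 0\<close>.\<close>

lemma lambda_S_ge_of_mu_eq_0:
  assumes "D \<in> Delta 3" "mu D = 0"
  shows "lambda_S 3 {3} D (5 / 8) \<ge> 15 / 128"
  using assms(1)
proof (cases rule: Delta_3_cases)
  case (1 q0 q1 q2 q3)
  then show ?thesis using assms(2) by (simp add: power_numeral_reduce)
qed

text \<open>Here \<gamma> is \<open>q3\<close>, and zero mean gives
  \<open>q3 = q0 + q1 - q2\<close>, at most the remaining mass \<open>1 - q3\<close>.\<close>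

lemma gamma_S_le_of_mu_eq_0:
  assumes "D \<in> Delta 3" "mu D = 0"
  shows "gamma_S 3 {3} D \<le> 1 / 2"
  using assms(1)
proof (cases rule: Delta_3_cases)
  case (1 q0 q1 q2 q3)
  then show ?thesis using assms(2) by (simp add: gamma_S_def)
qed

lemma lambda_S_mixture:
  assumes "is_mixture \<tau> D D0 D'" "D \<in> Delta k" "D0 \<in> Delta k" "D' \<in> Delta k"
  shows "lambda_S k {k} D p = \<tau> * lambda_S k {k} D0 p + (1 - \<tau>) * lambda_S k {k} D' p"
proof -
  have "pmf D x = \<tau> * pmf D0 x + (1 - \<tau>) * pmf D' x" for x
    using assms(1) by (simp add: is_mixture_def)
  then show ?thesis
    by (simp add: lambda_S_full[OF assms(2)] lambda_S_full[OF assms(3)] lambda_S_full[OF assms(4)]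
        sum.distrib sum_distrib_left distrib_right mult.assoc)
qed

lemma beta_S_ge_gamma_S:
  assumes "padded_one_wise_pair 3 DY DN"
  shows "beta_S 3 {3} DN \<ge> 15 / 64 * gamma_S 3 {3} DY"
proof -
  obtain \<tau> D0 DY' DN' where \<tau>: "\<tau> \<in> {0..1}"
    and mem: "DY \<in> Delta 3" "DN \<in> Delta 3" "D0 \<in> Delta 3" "DY' \<in> Delta 3" "DN' \<in> Delta 3"
    and mu: "mu DY' = 0" "mu DN' = 0"
    and mix: "is_mixture \<tau> DY D0 DY'" "is_mixture \<tau> DN D0 DN'"
    using assms unfolding padded_one_wise_pair_def by blast
  let ?g = "gamma_S 3 {3}" and ?l = "\<lambda>D. lambda_S 3 {3} D (5 / 8)"
  \<comment> \<open>There is slack here: 120/512 against 125/512.\<close>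
  have "15 / 64 * ?g D0 \<le> (5 / 8) ^ 3 * ?g D0"
    using gamma_S_nonneg[of 3 "{3}" D0] by (simp add: power_numeral_reduce)
  also have "\<dots> \<le> ?l D0" using mem by (intro lambda_S_ge_gamma_S) auto
  finally have common: "15 / 64 * ?g D0 \<le> ?l D0" .
  \<comment> \<open>This part fixes the constant: 15/64 is 15/128 divided by 1/2.\<close>
  have rest: "15 / 64 * ?g DY' \<le> ?l DN'"
    using gamma_S_le_of_mu_eq_0[of DY'] lambda_S_ge_of_mu_eq_0[of DN'] mem mu by simp
  have "15 / 64 * ?g DY = \<tau> * (15 / 64 * ?g D0) + (1 - \<tau>) * (15 / 64 * ?g DY')"
    unfolding gamma_S_def lambda_S_mixture[OF mix(1) mem(1,3,4)] by (simp add: distrib_left)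
  also have "\<dots> \<le> \<tau> * ?l D0 + (1 - \<tau>) * ?l DN'"
    using \<tau> common rest by (intro add_mono mult_left_mono) auto
  also have "\<dots> = ?l DN"
    using lambda_S_mixture[OF mix(2) mem(2,3,5)] by simp
  also have "\<dots> \<le> beta_S 3 {3} DN" by (rule lambda_S_le_beta_S) simp
  finally show ?thesis .
qed

text \<open>A zero denominator makes the ratio infinite, so only positive \<gamma> needs the
  estimate.\<close>

lemma ratio_ge:
  assumes "padded_one_wise_pair 3 DY DN"
  shows "ratio (beta_S 3 {3} DN) (gamma_S 3 {3} DY) \<ge> ereal (15 / 64)"
  using beta_S_ge_gamma_S[OF assms] gamma_S_nonneg[of 3 "{3}" DY]
  by (simp add: ratio_def pos_le_divide_eq)

theorem theorem2p12:
  "\<not> (\<exists>(DY :: nat \<Rightarrow> int list pmf) (DN :: nat \<Rightarrow> int list pmf).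
        (\<forall>t. padded_one_wise_pair 3 (DY t) (DN t)) \<and>
        (\<lambda>t. ratio (beta_S 3 {3} (DN t)) (gamma_S 3 {3} (DY t))) \<longlonglongrightarrow> ereal (2 / 9))"
proof clarify
  fix DY DN :: "nat \<Rightarrow> int list pmf"
  assume pair: "\<forall>t. padded_one_wise_pair 3 (DY t) (DN t)"
    and lim: "(\<lambda>t. ratio (beta_S 3 {3} (DN t)) (gamma_S 3 {3} (DY t))) \<longlonglongrightarrow> ereal (2 / 9)"
  have "ereal (15 / 64) \<le> ereal (2 / 9)"
    by (rule LIMSEQ_le_const[OF lim]) (use pair ratio_ge in blast)
  then show False by simp
qed

end
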